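(* Fix $\alpha\in(0,1)$. As $\ell_2(m)\to\infty$, the width $\Delta_{\alpha,m}(\lambda)=U_{\lambda,\alpha}(m)-L_{\lambda,\alpha}(m)$ of the two-sided $100(1-\alpha)\%$ level interval estimate $[L_{\lambda,\alpha}(m),U_{\lambda,\alpha}(m)]$ is asymptotically minimized over $\lambda$ at $\lambda=3/4$.
   Context: Let $\ell_2(m)=\log\log m$. Let $z_{\alpha/2}>0$ satisfy $\Phi(z_{\alpha/2})=1-\alpha/2$, where $\Phi$ is the standard normal distribution function. For $m$ sufficiently large (so that the expressions are defined), the interval is given by: - for $\lambda\ne0$: $L_{\lambda,\alpha}(m)=\ell_2(m)\,[1-z_{\alpha/2}\lambda/\sqrt{\ell_2(m)}]^{1/\lambda}$ and $U_{\lambda,\alpha}(m)=\ell_2(m)\,[1+z_{\alpha/2}\lambda/\sqrt{\ell_2(m)}]^{1/\lambda}$; - for $\lambda=0$: $L_{0,\alpha}(m)=\ell_2(m)\exp(-z_{\alpha/2}/\sqrt{\ell_2(m)})$ and $U_{0,\alpha}(m)=\ell_2(m)\exp(z_{\alpha/2}/\sqrt{\ell_2(m)})$. These arise as interval estimates for the number $\omega$ of distinct prime divisors of integers near $m$, from the Box–Cox-transformed Erdős–Kac theorem. *)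

theory Defs
  imports "HOL-Probability.Probability"
begin

definition ell2 :: "real \<Rightarrow> real" where
  "ell2 m = ln (ln m)"

text \<open>The parameter \<open>z\<close> is the upper \<open>\<alpha>/2\<close> quantile of the standard normal distribution.\<close>

definition ci_lower :: "real \<Rightarrow> real \<Rightarrow> real \<Rightarrow> real" where
  "ci_lower z lam m =
     (if lam = 0 then ell2 m * exp (- z / sqrt (ell2 m))
      else ell2 m * (1 - z * lam / sqrt (ell2 m)) powr (1 / lam))"

definition ci_upper :: "real \<Rightarrow> real \<Rightarrow> real \<Rightarrow> real" where
  "ci_upper z lam m =
     (if lam = 0 then ell2 m * exp (z / sqrt (ell2 m))
      else ell2 m * (1 + z * lam / sqrt (ell2 m)) powr (1 / lam))"

definition ci_width :: "real \<Rightarrow> real \<Rightarrow> real \<Rightarrow> real" where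
  "ci_width z m lam = ci_upper z lam m - ci_lower z lam m"

text \<open>
  The parameters for which both endpoints are defined at \<open>m\<close>. Positivity of the bases has to be
  demanded explicitly: \<open>powr\<close> is total, and its value at a base \<open>\<le> 0\<close> is not meaningful here.
  For fixed \<open>lam\<close> the condition holds for all sufficiently large \<open>m\<close>.
\<close>

definition ci_defined :: "real \<Rightarrow> real \<Rightarrow> real \<Rightarrow> bool" where
  "ci_defined z m lam \<longleftrightarrow>
     1 < m \<and> 0 < ell2 m \<and>
     0 < 1 - z * lam / sqrt (ell2 m) \<and> 0 < 1 + z * lam / sqrt (ell2 m)"

text \<open>
  A family \<open>f m\<close> of functions on the domains \<open>P m\<close> is asymptotically minimized at \<open>c\<close>:
  every other fixed point is eventually in the domain and strictly worse than \<open>c\<close>, and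
  eventually \<open>f m\<close> attains its minimum over the domain, with all minimizers tending to \<open>c\<close>.
\<close>

definition asymptotically_minimized_at ::
    "('a \<Rightarrow> real \<Rightarrow> real) \<Rightarrow> ('a \<Rightarrow> real \<Rightarrow> bool) \<Rightarrow> 'a filter \<Rightarrow> real \<Rightarrow> bool" where
  "asymptotically_minimized_at f P F c \<longleftrightarrow>
     (\<forall>x. x \<noteq> c \<longrightarrow> (\<forall>\<^sub>F m in F. P m c \<and> P m x \<and> f m c < f m x)) \<and>
     (\<forall>\<epsilon>>0. \<forall>\<^sub>F m in F.
        (\<exists>x. is_arg_min (f m) (P m) x) \<and>
        (\<forall>x. is_arg_min (f m) (P m) x \<longrightarrow> \<bar>x - c\<bar> < \<epsilon>))"

text \<open>Along \<open>m \<rightarrow> \<infinity>\<close> is the same as along \<open>ell2 m \<rightarrow> \<infinity>\<close>, as \<open>ell2\<close> is increasing for \<open>m > 1\<close>.\<close>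

lemma filterlim_ell2: "filterlim ell2 at_top at_top"
  unfolding ell2_def by (intro filterlim_compose[OF ln_at_top] ln_at_top)

end

theory Submission
  imports Defs "HOL-Real_Asymp.Real_Asymp"
begin

text \<open>
  Put \<open>e = z / sqrt (ell2 m)\<close>, \<open>t = lam * e\<close> and \<open>g u = ln (1 + u) / u\<close>. The width divided by
  \<open>ell2 m\<close> is \<open>exp (e * g t) - exp (- e * g (- t)) = 2 * exp (e * s) * sinh (e * d)\<close>, where
  \<open>s = (g t - g (- t)) / 2\<close> is about \<open>- t / 2\<close> and \<open>d = (g t + g (- t)) / 2\<close> is about \<open>1 + t\<^sup>2 / 3\<close>.
  Hence it is \<open>2 * e * (1 + e\<^sup>2 * ((lam - 3/4)\<^sup>2 / 3 - 1/48))\<close> up to terms of higher order.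
  As \<open>lam\<close> ranges over the interval \<open>\<bar>t\<bar> < 1\<close>, which grows with \<open>m\<close>, the comparison with
  \<open>lam = 3/4\<close> has to be uniform in \<open>lam\<close>: for \<open>t \<le> 1/2\<close> the error term \<open>e\<^sup>3 * (lam\<^sup>2 + \<bar>lam\<bar>)\<close> is
  absorbed by \<open>(lam - 3/4)\<^sup>2\<close>, and for \<open>t \<ge> 1/2\<close> the width exceeds its first-order value \<open>2 * e\<close>.
  A minimizer therefore exists by compactness of a neighbourhood of \<open>3/4\<close>.
\<close>

section \<open>Reduction to a function of \<open>e\<close> and \<open>lam\<close>\<close>

definition log_slope :: "real \<Rightarrow> real" where
  "log_slope u = (if u = 0 then 1 else ln (1 + u) / u)"

definition scaled_width :: "real \<Rightarrow> real \<Rightarrow> real" where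
  "scaled_width e lam = exp (e * log_slope (lam * e)) - exp (- (e * log_slope (- (lam * e))))"

text \<open>For positive bases \<open>powr\<close> is an exponential, with exponent ln (1 + t) / lam
  = \<open>e * log_slope t\<close> at the upper end. The value 1 of \<open>log_slope\<close> at 0 is
  its limit there, so the branch lam = 0 has the same form.\<close>

lemma ci_width_eq_scaled_width:
  assumes "0 < z" and "ci_defined z m lam"
  shows "ci_width z m lam = ell2 m * scaled_width (z / sqrt (ell2 m)) lam"
proof (cases "lam = 0")
  case True
  then show ?thesis
    by (simp add: ci_width_def ci_upper_def ci_lower_def scaled_width_def log_slope_def algebra_simps)
next
  case False
  have "0 < ell2 m" using assms by (simp add: ci_defined_def)
  then have "0 < sqrt (ell2 m)" by simp
  moreover have "1 - z * lam / sqrt (ell2 m) \<noteq> 0" "1 + z * lam / sqrt (ell2 m) \<noteq> 0"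
    using assms unfolding ci_defined_def by linarith+
  ultimately show ?thesis
    using False assms(1)
    by (simp add: ci_width_def ci_upper_def ci_lower_def scaled_width_def log_slope_def
        powr_def algebra_simps)
qed

section \<open>Elementary bounds for sinh and \<open>log_slope\<close>\<close>

lemma sinh_ge_self:
  fixes y :: real
  assumes "0 \<le> y"
  shows "y \<le> sinh y"
proof -
  have "sinh 0 - 0 \<le> sinh y - y"
  proof (rule DERIV_nonneg_imp_nondecreasing[OF assms])
    fix x :: real
    show "\<exists>D. ((\<lambda>y. sinh y - y) has_real_derivative D) (at x) \<and> 0 \<le> D"
      by (rule exI[of _ "cosh x - 1"]) (auto intro!: derivative_eq_intros simp: cosh_real_ge_1)
  qed
  then show ?thesis by simp
qed

text \<open>The cubic term matters: it has the same order as the dependence of the width on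
  \<open>lam\<close>.\<close>

lemma sinh_ge_cubic:
  fixes y :: real
  assumes "0 \<le> y"
  shows "y + y ^ 3 / 6 \<le> sinh y"
proof -
  have "sinh 0 - 0 - 0 ^ 3 / 6 \<le> sinh y - y - y ^ 3 / 6"
  proof (rule DERIV_nonneg_imp_nondecreasing[OF assms])
    fix x :: real
    assume "0 \<le> x"
    then have "(x / 2)\<^sup>2 \<le> (sinh (x / 2))\<^sup>2"
      by (intro power_mono sinh_ge_self) auto
    \<comment> \<open>The half-angle formula turns \<open>sinh_ge_self\<close> into cosh x >= 1 +
      x^2/2, which gives the sign of the derivative.\<close>
    moreover have "cosh x = 2 * (sinh (x / 2))\<^sup>2 + 1"
      using cosh_double[of "x / 2"] cosh_square_eq[of "x / 2"] by simp
    ultimately have "0 \<le> cosh x - 1 - x\<^sup>2 / 2"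
      by (simp add: power2_eq_square)
    then show "\<exists>D. ((\<lambda>y. sinh y - y - y ^ 3 / 6) has_real_derivative D) (at x) \<and> 0 \<le> D"
      by (intro exI[of _ "cosh x - 1 - x\<^sup>2 / 2"])
        (auto intro!: derivative_eq_intros)
  qed
  then show ?thesis by simp
qed

lemma log_slope_nonneg:
  assumes "-1 < u"
  shows "0 \<le> log_slope u"
proof (cases "0 < u")
  case True
  then show ?thesis by (simp add: log_slope_def)
next
  case False
  then have "ln (1 + u) \<le> 0" using assms by simp
  with False show ?thesis by (simp add: log_slope_def divide_nonpos_nonpos)
qed

text \<open>The left side truncates the power series of 2 artanh t, whose coefficients are
  nonnegative.\<close>

lemma ln_one_plus_minus_ge:
  fixes t :: real
  assumes "0 \<le> t" and "t < 1"
  shows "2 * t + 2 * t ^ 3 / 3 \<le> ln (1 + t) - ln (1 - t)"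
proof -
  have "ln (1 + 0) - ln (1 - 0) - 2 * 0 - 2 * 0 ^ 3 / 3 \<le> ln (1 + t) - ln (1 - t) - 2 * t - 2 * t ^ 3 / 3"
  proof (rule DERIV_nonneg_imp_nondecreasing[OF assms(1)])
    fix x :: real
    assume "0 \<le> x" "x \<le> t"
    then have x: "0 \<le> x" "x < 1" using assms by auto
    have "1 / (1 + x) + 1 / (1 - x) - 2 - 2 * x\<^sup>2 = 2 * x ^ 4 / ((1 + x) * (1 - x))"
      using x by (simp add: divide_simps) algebra
    also have "\<dots> \<ge> 0" using x by (intro divide_nonneg_nonneg mult_nonneg_nonneg) auto
    finally show "\<exists>D. ((\<lambda>t. ln (1 + t) - ln (1 - t) - 2 * t - 2 * t ^ 3 / 3) has_real_derivative D) (at x) \<and> 0 \<le> D"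
      using x by (intro exI[of _ "1 / (1 + x) + 1 / (1 - x) - 2 - 2 * x\<^sup>2"])
        (auto intro!: derivative_eq_intros)
  qed
  then show ?thesis by simp
qed

lemma log_slope_sum_ge:
  assumes "\<bar>t\<bar> < 1"
  shows "2 + 2 * t\<^sup>2 / 3 \<le> log_slope t + log_slope (- t)"
proof -
  have pos: "2 + 2 * u\<^sup>2 / 3 \<le> log_slope u + log_slope (- u)" if "0 < u" "u < 1" for u
  proof -
    have "(2 + 2 * u\<^sup>2 / 3) * u \<le> ln (1 + u) - ln (1 - u)"
      using ln_one_plus_minus_ge[of u] that by (simp add: algebra_simps power2_eq_square power3_eq_cube)
    then have "2 + 2 * u\<^sup>2 / 3 \<le> (ln (1 + u) - ln (1 - u)) / u"
      using that by (simp add: pos_le_divide_eq)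
    then show ?thesis using that by (simp add: log_slope_def diff_divide_distrib)
  qed
  consider "t = 0" | "0 < t" | "t < 0" by linarith
  then show ?thesis
  proof cases
    case 1
    then show ?thesis by (simp add: log_slope_def)
  next
    case 2
    with pos[of t] assms show ?thesis by simp
  next
    case 3
    with pos[of "- t"] assms show ?thesis by simp
  qed
qed

lemma log_slope_diff:
  assumes "\<bar>t\<bar> < 1"
  shows "log_slope t - log_slope (- t) = ln (1 - t\<^sup>2) / t"
proof (cases "t = 0")
  case False
  have "ln ((1 + t) * (1 - t)) = ln (1 + t) + ln (1 - t)"
    using assms by (subst ln_mult) auto
  moreover have "(1 + t) * (1 - t) = 1 - t\<^sup>2" by (simp add: algebra_simps power2_eq_square)
  ultimately show ?thesis using False by (simp add: log_slope_def add_divide_distrib)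
qed (simp add: log_slope_def)

text \<open>Division by a negative \<open>t\<close> reverses the inequality, so ln y <= y - 1
  suffices and no error term appears.\<close>

lemma log_slope_diff_ge_nonpos:
  assumes "-1 < t" and "t \<le> 0"
  shows "- t \<le> log_slope t - log_slope (- t)"
proof (cases "t = 0")
  case False
  then have t: "t < 0" using assms by simp
  have "t\<^sup>2 < 1" using assms by (simp add: power2_less_1_iff abs_square_less_1)
  then have "ln (1 - t\<^sup>2) \<le> - t\<^sup>2" using ln_le_minus_one[of "1 - t\<^sup>2"] by simp
  then have "- t \<le> ln (1 - t\<^sup>2) / t"
    using t by (simp add: neg_le_divide_eq power2_eq_square)
  then show ?thesis using log_slope_diff[of t] assms by simp
qed (simp add: log_slope_def)

text \<open>For positive \<open>t\<close> a lower bound for ln (1 - t^2) is needed; it costs a cubic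
  error and keeps \<open>t\<close> away from 1.\<close>

lemma log_slope_diff_ge_nonneg:
  assumes "0 \<le> t" and "t \<le> 1 / 2"
  shows "- (t + 2 * t ^ 3) \<le> log_slope t - log_slope (- t)"
proof (cases "t = 0")
  case False
  then have t: "0 < t" using assms by simp
  have "t\<^sup>2 \<le> (1 / 2)\<^sup>2" using assms by (intro power_mono) auto
  then have "t\<^sup>2 \<le> 1 / 2" by (simp add: power2_eq_square)
  then have "- t\<^sup>2 - 2 * (t\<^sup>2)\<^sup>2 \<le> ln (1 - t\<^sup>2)"
    by (intro ln_one_minus_pos_lower_bound) auto
  moreover have "- (t + 2 * t ^ 3) * t = - t\<^sup>2 - 2 * (t\<^sup>2)\<^sup>2"
    by algebra
  ultimately have "- (t + 2 * t ^ 3) \<le> ln (1 - t\<^sup>2) / t"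
    using t by (simp add: pos_le_divide_eq)
  then show ?thesis using log_slope_diff[of t] assms by simp
qed (simp add: log_slope_def)

section \<open>Lower bounds for the scaled width\<close>

lemma exp_diff_eq_sinh:
  fixes x y :: real
  shows "exp x - exp (- y) = 2 * exp ((x - y) / 2) * sinh ((x + y) / 2)"
  by (simp add: sinh_field_def algebra_simps flip: exp_add) (simp add: field_simps)

text \<open>The exponential and the sinh factor are bounded separately. The parameter
  \<open>r\<close> admits either of the two estimates for the difference of slopes, according to the
  sign of \<open>lam\<close>.\<close>

lemma scaled_width_ge_product:
  assumes "0 < e" and "\<bar>lam * e\<bar> < 1"
    and "r \<le> log_slope (lam * e) - log_slope (- (lam * e))"
  shows "2 * e * ((1 + e * r / 2) * (1 + (lam * e)\<^sup>2 / 3 + e\<^sup>2 / 6)) \<le> scaled_width e lam"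
proof -
  define t where "t = lam * e"
  define s where "s = (log_slope t - log_slope (- t)) / 2"
  define d where "d = (log_slope t + log_slope (- t)) / 2"
  have d: "1 + t\<^sup>2 / 3 \<le> d" using log_slope_sum_ge[of t] assms by (simp add: d_def t_def)
  have "0 \<le> t\<^sup>2 / 3" by simp
  with d have d1: "1 \<le> d" by linarith
  then have "e ^ 3 \<le> (e * d) ^ 3" using assms by (intro power_mono) auto
  then have "e * (1 + t\<^sup>2 / 3) + e ^ 3 / 6 \<le> e * d + (e * d) ^ 3 / 6"
    using d assms by (intro add_mono mult_left_mono) auto
  then have "e * (1 + t\<^sup>2 / 3 + e\<^sup>2 / 6) \<le> e * d + (e * d) ^ 3 / 6"
    by (simp add: distrib_left power2_eq_square power3_eq_cube)
  also have "\<dots> \<le> sinh (e * d)" using assms d1 by (intro sinh_ge_cubic) auto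
  finally have S: "e * (1 + t\<^sup>2 / 3 + e\<^sup>2 / 6) \<le> sinh (e * d)" .
  have "1 + e * r / 2 \<le> 1 + e * s"
    using mult_left_mono[OF assms(3), of e] assms(1) by (simp add: s_def t_def)
  also have "\<dots> \<le> exp (e * s)" by simp
  finally have "1 + e * r / 2 \<le> exp (e * s)" .
  \<comment> \<open>Replacing the exponential factor first makes the sign of
    \<open>1 + e * r / 2\<close> irrelevant.\<close>
  then have "(1 + e * r / 2) * (e * (1 + t\<^sup>2 / 3 + e\<^sup>2 / 6)) \<le> exp (e * s) * (e * (1 + t\<^sup>2 / 3 + e\<^sup>2 / 6))"
    using assms by (intro mult_right_mono) auto
  also have "\<dots> \<le> exp (e * s) * sinh (e * d)" using S by (intro mult_left_mono) auto
  finally have "2 * ((1 + e * r / 2) * (e * (1 + t\<^sup>2 / 3 + e\<^sup>2 / 6))) \<le> 2 * exp (e * s) * sinh (e * d)"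
    by simp
  also have "\<dots> = scaled_width e lam"
    using exp_diff_eq_sinh[of "e * log_slope t" "e * log_slope (- t)"]
    by (simp add: scaled_width_def s_def d_def t_def algebra_simps)
  finally show ?thesis by (simp add: t_def mult_ac)
qed

lemma scaled_width_ge_quadratic:
  assumes e: "0 < e" "e \<le> 1" and t: "-1 < lam * e" "lam * e \<le> 1 / 2"
  shows "2 * e * (1 + e\<^sup>2 * ((lam - 3 / 4)\<^sup>2 / 3 - 1 / 48) - e ^ 3 * (lam\<^sup>2 + \<bar>lam\<bar>))
    \<le> scaled_width e lam"
proof -
  define u where "u = lam * e"
  \<comment> \<open>Completing the square in lam^2/3 - lam/2 + 1/6 produces the vertex 3/4; 1/6 is
    the cubic coefficient of sinh.\<close>
  have eq: "1 + e\<^sup>2 * ((lam - 3 / 4)\<^sup>2 / 3 - 1 / 48) = 1 + (u\<^sup>2 / 3 + e\<^sup>2 / 6) - e * u / 2"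
    by (simp add: u_def power2_eq_square field_simps)
  have err: "e ^ 3 * (lam\<^sup>2 + \<bar>lam\<bar>) = e * (u\<^sup>2 + e * \<bar>u\<bar>)"
    using e by (simp add: u_def power2_eq_square power3_eq_cube abs_mult field_simps)
  show ?thesis
  proof (cases "0 \<le> lam")
    case True
    then have u: "0 \<le> u" "u \<le> 1 / 2" using e t by (auto simp: u_def)
    define q where "q = u\<^sup>2 / 3 + e\<^sup>2 / 6"
    \<comment> \<open>The product to be reached is \<open>1 + q - e * u / 2\<close> minus e/2 times
      \<open>2 * u ^ 3 + u * q * (1 + 2 * u^2)\<close>. The following estimates bound this last
      factor by \<open>2 * (u^2 + e * u)\<close>.\<close>
    have u2: "u\<^sup>2 \<le> 1 / 4" using power_mono[OF u(2,1), of 2] by (simp add: power2_eq_square)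
    have u3: "u ^ 3 \<le> u\<^sup>2 / 2"
      using mult_left_mono[OF u(2), of "u\<^sup>2"] by (simp add: power2_eq_square power3_eq_cube)
    have e2: "e\<^sup>2 * u \<le> e * u"
      using e u by (intro mult_right_mono) (auto simp: power2_eq_square mult_left_le)
    have q: "u * q \<le> (u\<^sup>2 + e * u) / 6"
      using u3 e2 by (simp add: q_def algebra_simps power2_eq_square power3_eq_cube)
    have "0 \<le> u * q" using u by (simp add: q_def)
    then have "u * q * (1 + 2 * u\<^sup>2) \<le> u * q * (3 / 2)" using u2 by (intro mult_left_mono) auto
    also have "\<dots> \<le> (u\<^sup>2 + e * u) / 6 * (3 / 2)" using q by (rule mult_right_mono) simp
    also have "\<dots> \<le> u\<^sup>2 + e * u"
      using e u by (simp add: field_simps)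
    finally have "2 * u ^ 3 + u * q * (1 + 2 * u\<^sup>2) \<le> u\<^sup>2 + (u\<^sup>2 + e * u)"
      using u3 by (intro add_mono) auto
    also have "\<dots> \<le> 2 * (u\<^sup>2 + e * u)" using e u by simp
    finally have "e * (2 * u ^ 3 + u * q * (1 + 2 * u\<^sup>2)) \<le> e * (2 * (u\<^sup>2 + e * u))"
      using e by (intro mult_left_mono) auto
    then have "e * (2 * u ^ 3 + u * q * (1 + 2 * u\<^sup>2)) / 2 \<le> e * (u\<^sup>2 + e * u)"
      by (simp only: mult.left_commute[of e 2])
    then have "1 + q - e * u / 2 - e * (u\<^sup>2 + e * u)
      \<le> 1 + q - e * u / 2 - e * (2 * u ^ 3 + u * q * (1 + 2 * u\<^sup>2)) / 2"
      by (rule diff_left_mono)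
    also have "\<dots> = (1 + e * (- (u + 2 * u ^ 3)) / 2) * (1 + q)"
      by (simp add: field_simps power2_eq_square power3_eq_cube)
    finally have "1 + q - e * u / 2 - e * (u\<^sup>2 + e * u)
      \<le> (1 + e * (- (u + 2 * u ^ 3)) / 2) * (1 + q)" .
    then have "2 * e * (1 + q - e * u / 2 - e * (u\<^sup>2 + e * u))
      \<le> 2 * e * ((1 + e * (- (u + 2 * u ^ 3)) / 2) * (1 + q))"
      using e by (intro mult_left_mono) auto
    also have "\<dots> \<le> scaled_width e lam"
      using scaled_width_ge_product[OF e(1) _ log_slope_diff_ge_nonneg[OF u, unfolded u_def]] t u
      by (simp add: u_def q_def add_ac)
    finally show ?thesis unfolding eq err using u by (simp add: q_def)
  next
    case False
    then have u: "-1 < u" "u \<le> 0" using e t by (auto simp: u_def mult_nonpos_nonneg)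
    define q where "q = u\<^sup>2 / 3 + e\<^sup>2 / 6"
    have "0 \<le> q" by (simp add: q_def)
    moreover have "e * u \<le> 0" using e u by (simp add: mult_nonneg_nonpos)
    ultimately have "e * u * q \<le> 0" by (simp add: mult_nonpos_nonneg)
    moreover have "0 \<le> e * (u\<^sup>2 + e * \<bar>u\<bar>)" using e by simp
    ultimately have "1 + q - e * u / 2 - e * (u\<^sup>2 + e * \<bar>u\<bar>) \<le> (1 + e * (- u) / 2) * (1 + q)"
      by (simp add: algebra_simps)
    then have "2 * e * (1 + q - e * u / 2 - e * (u\<^sup>2 + e * \<bar>u\<bar>))
      \<le> 2 * e * ((1 + e * (- u) / 2) * (1 + q))"
      using e by (intro mult_left_mono) auto
    also have "\<dots> \<le> scaled_width e lam"
      using scaled_width_ge_product[OF e(1) _ log_slope_diff_ge_nonpos[OF u, unfolded u_def]] u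
      by (simp add: u_def q_def add_ac)
    finally show ?thesis unfolding eq err by (simp add: q_def)
  qed
qed

lemma exp_minus_le_quadratic:
  fixes x :: real
  assumes "0 \<le> x"
  shows "exp (- x) \<le> 1 - x + x\<^sup>2 / 2"
proof -
  have "exp (- 0) - (1 - 0 + 0\<^sup>2 / 2) \<ge> exp (- x) - (1 - x + x\<^sup>2 / 2)"
  proof (rule DERIV_nonpos_imp_nonincreasing[OF assms])
    fix y :: real
    have "1 - y \<le> exp (- y)" using exp_ge_add_one_self[of "- y"] by simp
    then show "\<exists>D. ((\<lambda>x. exp (- x) - (1 - x + x\<^sup>2 / 2)) has_real_derivative D) (at y) \<and> D \<le> 0"
      by (intro exI[of _ "- exp (- y) + 1 - y"]) (auto intro!: derivative_eq_intros)
  qed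
  then show ?thesis by simp
qed

text \<open>Here \<open>log_slope (- (lam * e))\<close> is unbounded as \<open>lam * e\<close> tends to 1; truncating it at 3 makes the
  quadratic expansion of the second exponential uniform.\<close>

lemma scaled_width_ge_linear:
  assumes e: "0 < e" "e \<le> 1 / 27" and t: "1 / 2 \<le> lam * e" "lam * e < 1"
  shows "2 * e \<le> scaled_width e lam"
proof -
  define a where "a = log_slope (lam * e)"
  define b where "b = log_slope (- (lam * e))"
  define b' where "b' = min b 3"
  have nonneg: "0 \<le> a" "0 \<le> b" using t by (auto simp: a_def b_def intro!: log_slope_nonneg)
  have "(1 / 2)\<^sup>2 \<le> (lam * e)\<^sup>2" using t by (intro power_mono) auto
  then have "13 / 6 \<le> a + b"
    using log_slope_sum_ge[of "lam * e"] t by (simp add: a_def b_def power2_eq_square)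
  \<comment> \<open>If the truncation is active, then b' = 3 and a >= 0 give the bound.\<close>
  then have ab: "13 / 6 \<le> a + b'" using nonneg by (auto simp: b'_def min_def)
  have b': "0 \<le> b'" "b' \<le> 3" using nonneg by (auto simp: b'_def)
  have "b'\<^sup>2 \<le> 3\<^sup>2" using b' by (intro power_mono)
  \<comment> \<open>The bound 1/27 makes half of (e * b')^2 at most e/6, exactly what the excess of
    13/6 over 2 pays for.\<close>
  then have "e * (e * b'\<^sup>2) \<le> (1 / 27) * (e * 9)" using e by (intro mult_mono) auto
  then have sq: "(e * b')\<^sup>2 \<le> e / 3" by (simp add: power2_eq_square mult_ac)
  have "exp (- (e * b)) \<le> exp (- (e * b'))" using e by (simp add: b'_def)
  also have "\<dots> \<le> 1 - e * b' + (e * b')\<^sup>2 / 2" using e b' by (intro exp_minus_le_quadratic) auto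
  finally have "1 + e * a - (1 - e * b' + e / 6) \<le> exp (e * a) - exp (- (e * b))"
    using sq exp_ge_add_one_self[of "e * a"] by linarith
  moreover have "e * (13 / 6) \<le> e * (a + b')" using ab e by (intro mult_left_mono) auto
  ultimately show ?thesis by (simp add: scaled_width_def a_def b_def algebra_simps)
qed

section \<open>Comparison with lam = 3/4 for small \<open>e\<close>\<close>

lemma scaled_width_at_three_quarters:
  assumes "0 < \<eta>"
  shows "\<forall>\<^sub>F e in at_right 0. scaled_width e (3 / 4) < 2 * e * (1 - e\<^sup>2 / 48 + \<eta> * e\<^sup>2)"
proof -
  \<comment> \<open>At lam = 3/4 the expansion is 2e (1 - e^2/48 + o(e^2)); the slack \<eta> absorbs
    the remainder.\<close>
  have "\<forall>\<^sub>F e :: real in at_right 0. exp (4 / 3 * ln (1 + 3 / 4 * e)) - exp (4 / 3 * ln (1 - 3 / 4 * e))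
      < 2 * e * (1 - e\<^sup>2 / 48 + \<eta> * e\<^sup>2)"
    using assms by real_asymp
  moreover have "\<forall>\<^sub>F e :: real in at_right 0. 0 < e" by (rule eventually_at_right_less)
  ultimately show ?thesis
    by eventually_elim (simp add: scaled_width_def log_slope_def mult.commute)
qed

lemma scaled_width_gt_away:
  assumes "0 < \<epsilon>"
  shows "\<forall>\<^sub>F e in at_right 0. \<forall>lam. \<bar>lam * e\<bar> < 1 \<longrightarrow> \<epsilon> \<le> \<bar>lam - 3 / 4\<bar> \<longrightarrow>
    scaled_width e (3 / 4) < scaled_width e lam"
proof -
  \<comment> \<open>\<open>K\<close> is chosen so that 3 \<mu>^2 + 9/4 <= K \<mu>^2 once \<mu>^2 >=
    \<epsilon>^2. With e < 1/(6K) the error takes at most half of the gain \<mu>^2/3, leaving at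
    least the slack \<epsilon>^2/6.\<close>
  define K where "K = 3 + 9 / (4 * \<epsilon>\<^sup>2)"
  have K: "0 < K" using assms by (simp add: K_def add_pos_nonneg)
  have "\<forall>\<^sub>F e in at_right 0. scaled_width e (3 / 4) < 2 * e * (1 - e\<^sup>2 / 48 + \<epsilon>\<^sup>2 / 6 * e\<^sup>2)"
    using assms by (intro scaled_width_at_three_quarters) simp
  \<comment> \<open>The slack 1/48 cancels the correction, so the width at 3/4 is below
    \<open>2 * e\<close>, the bound available for t >= 1/2.\<close>
  moreover have "\<forall>\<^sub>F e in at_right 0. scaled_width e (3 / 4) < 2 * e * (1 - e\<^sup>2 / 48 + 1 / 48 * e\<^sup>2)"
    by (intro scaled_width_at_three_quarters) simp
  moreover have "\<forall>\<^sub>F e :: real in at_right 0. 0 < e \<and> e < min (1 / 27) (1 / (6 * K))"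
    using K by (intro eventually_at_rightI[of 0 "min (1 / 27) (1 / (6 * K))"]) auto
  ultimately show ?thesis
  proof (eventually_elim, intro allI impI)
    fix e lam :: real
    assume near: "scaled_width e (3 / 4) < 2 * e * (1 - e\<^sup>2 / 48 + \<epsilon>\<^sup>2 / 6 * e\<^sup>2)"
      and lin: "scaled_width e (3 / 4) < 2 * e * (1 - e\<^sup>2 / 48 + 1 / 48 * e\<^sup>2)"
      and e: "0 < e \<and> e < min (1 / 27) (1 / (6 * K))"
      and t: "\<bar>lam * e\<bar> < 1" and far: "\<epsilon> \<le> \<bar>lam - 3 / 4\<bar>"
    show "scaled_width e (3 / 4) < scaled_width e lam"
    proof (cases "lam * e \<le> 1 / 2")
      case False
      then have "2 * e \<le> scaled_width e lam" using e t by (intro scaled_width_ge_linear) auto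
      with lin show ?thesis by simp
    next
      case True
      define \<mu> where "\<mu> = lam - 3 / 4"
      have mu: "\<epsilon>\<^sup>2 \<le> \<mu>\<^sup>2"
        using power_mono[OF far, of 2] assms by (simp add: \<mu>_def)
      have "\<bar>lam\<bar> \<le> lam\<^sup>2 / 2 + 1 / 2"
        using zero_le_power2[of "\<bar>lam\<bar> - 1"] by (simp add: power2_eq_square algebra_simps)
      moreover have "lam\<^sup>2 \<le> 2 * \<mu>\<^sup>2 + 9 / 8"
        using zero_le_power2[of "\<mu> - 3 / 4"] by (simp add: \<mu>_def power2_eq_square algebra_simps)
      ultimately have "lam\<^sup>2 + \<bar>lam\<bar> \<le> 3 * \<mu>\<^sup>2 + 9 / 4" by simp
      also have "\<dots> \<le> K * \<mu>\<^sup>2"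
        using mu assms by (simp add: K_def field_simps)
      finally have "e * (lam\<^sup>2 + \<bar>lam\<bar>) \<le> e * (K * \<mu>\<^sup>2)" using e by (intro mult_left_mono) auto
      also have "\<dots> \<le> 1 / 6 * \<mu>\<^sup>2"
        using e K mult_right_mono[of "e * K" "1 / 6" "\<mu>\<^sup>2"] by (simp add: field_simps)
      finally have "e * (lam\<^sup>2 + \<bar>lam\<bar>) \<le> \<mu>\<^sup>2 / 6" by simp
      with mu have "\<epsilon>\<^sup>2 / 6 \<le> \<mu>\<^sup>2 / 3 - e * (lam\<^sup>2 + \<bar>lam\<bar>)" by simp
      then have "e\<^sup>2 * (\<epsilon>\<^sup>2 / 6) \<le> e\<^sup>2 * (\<mu>\<^sup>2 / 3 - e * (lam\<^sup>2 + \<bar>lam\<bar>))"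
        by (intro mult_left_mono) auto
      then have "1 - e\<^sup>2 / 48 + \<epsilon>\<^sup>2 / 6 * e\<^sup>2
          \<le> 1 + e\<^sup>2 * (\<mu>\<^sup>2 / 3 - 1 / 48) - e ^ 3 * (lam\<^sup>2 + \<bar>lam\<bar>)"
        by (simp add: algebra_simps power2_eq_square power3_eq_cube)
      then have "2 * e * (1 - e\<^sup>2 / 48 + \<epsilon>\<^sup>2 / 6 * e\<^sup>2)
          \<le> 2 * e * (1 + e\<^sup>2 * (\<mu>\<^sup>2 / 3 - 1 / 48) - e ^ 3 * (lam\<^sup>2 + \<bar>lam\<bar>))"
        using e by (intro mult_left_mono) auto
      also have "\<dots> \<le> scaled_width e lam"
        unfolding \<mu>_def using e t True by (intro scaled_width_ge_quadratic) auto
      finally show ?thesis using near by simp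
    qed
  qed
qed

section \<open>Transfer to large \<open>m\<close>\<close>

lemma ci_defined_iff:
  "ci_defined z m lam \<longleftrightarrow> 1 < m \<and> 0 < ell2 m \<and> \<bar>lam * (z / sqrt (ell2 m))\<bar> < 1"
proof -
  have "z * lam / sqrt (ell2 m) = lam * (z / sqrt (ell2 m))" by simp
  then show ?thesis unfolding ci_defined_def by linarith
qed

lemma filterlim_ci_scale:
  assumes "0 < z"
  shows "filterlim (\<lambda>m. z / sqrt (ell2 m)) (at_right 0) at_top"
proof -
  have "filterlim (\<lambda>x. z / sqrt x) (at_right 0) at_top"
    using assms by real_asymp
  then show ?thesis using filterlim_ell2 by (rule filterlim_compose)
qed

text \<open>Uniformity in \<open>lam\<close> puts a whole compact interval around 3/4 inside the
  domain for one and the same \<open>m\<close>.\<close>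

lemma eventually_ci_defined_bounded:
  assumes "0 < z" and "0 < B"
  shows "\<forall>\<^sub>F m in at_top. \<forall>lam. \<bar>lam\<bar> \<le> B \<longrightarrow> ci_defined z m lam"
proof -
  have "\<forall>\<^sub>F e :: real in at_right 0. 0 < e \<and> e < 1 / B"
    using assms by (intro eventually_at_rightI[of 0 "1 / B"]) auto
  then have "\<forall>\<^sub>F m in at_top. 0 < z / sqrt (ell2 m) \<and> z / sqrt (ell2 m) < 1 / B"
    using filterlim_ci_scale[OF assms(1)] by (rule eventually_compose_filterlim)
  moreover have "\<forall>\<^sub>F m in at_top. 0 < ell2 m"
    using filterlim_ell2 by (simp add: filterlim_at_top_dense)
  moreover have "\<forall>\<^sub>F m :: real in at_top. 1 < m" by (rule eventually_gt_at_top)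
  ultimately show ?thesis
  proof (eventually_elim, intro allI impI)
    fix m lam :: real
    assume e: "0 < z / sqrt (ell2 m) \<and> z / sqrt (ell2 m) < 1 / B"
      and m: "0 < ell2 m" "1 < m" and lam: "\<bar>lam\<bar> \<le> B"
    have "\<bar>lam * (z / sqrt (ell2 m))\<bar> \<le> B * (z / sqrt (ell2 m))"
      using lam e by (simp only: abs_mult) (intro mult_mono, auto)
    also have "\<dots> < B * (1 / B)" using e assms(2) by (intro mult_strict_left_mono) auto
    finally show "ci_defined z m lam" using m assms(2) by (simp add: ci_defined_iff)
  qed
qed

lemma ci_width_gt_away:
  assumes "0 < z" and "0 < \<epsilon>"
  shows "\<forall>\<^sub>F m in at_top. \<forall>lam. ci_defined z m lam \<longrightarrow> \<epsilon> \<le> \<bar>lam - 3 / 4\<bar> \<longrightarrow>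
    ci_width z m (3 / 4) < ci_width z m lam"
proof -
  have "\<forall>\<^sub>F m in at_top. ci_defined z m (3 / 4)"
    using eventually_ci_defined_bounded[OF assms(1), of 1] by (auto elim: eventually_mono)
  moreover have "\<forall>\<^sub>F m in at_top. \<forall>lam. \<bar>lam * (z / sqrt (ell2 m))\<bar> < 1 \<longrightarrow>
      \<epsilon> \<le> \<bar>lam - 3 / 4\<bar> \<longrightarrow>
      scaled_width (z / sqrt (ell2 m)) (3 / 4) < scaled_width (z / sqrt (ell2 m)) lam"
    using scaled_width_gt_away[OF assms(2)] filterlim_ci_scale[OF assms(1)]
    by (rule eventually_compose_filterlim)
  ultimately show ?thesis
  proof (eventually_elim, intro allI impI)
    fix m lam
    assume c: "ci_defined z m (3 / 4)" and d: "ci_defined z m lam" and far: "\<epsilon> \<le> \<bar>lam - 3 / 4\<bar>"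
      and less: "\<forall>lam. \<bar>lam * (z / sqrt (ell2 m))\<bar> < 1 \<longrightarrow> \<epsilon> \<le> \<bar>lam - 3 / 4\<bar> \<longrightarrow>
        scaled_width (z / sqrt (ell2 m)) (3 / 4) < scaled_width (z / sqrt (ell2 m)) lam"
    have "scaled_width (z / sqrt (ell2 m)) (3 / 4) < scaled_width (z / sqrt (ell2 m)) lam"
      using less d far unfolding ci_defined_iff by blast
    then show "ci_width z m (3 / 4) < ci_width z m lam"
      using d unfolding ci_width_eq_scaled_width[OF assms(1) c] ci_width_eq_scaled_width[OF assms(1) d]
      by (simp add: ci_defined_def)
  qed
qed

section \<open>Existence and location of the minimizers\<close>

lemma continuous_on_ci_width:
  assumes "\<And>lam. lam \<in> S \<Longrightarrow> lam \<noteq> 0 \<and> ci_defined z m lam"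
  shows "continuous_on S (ci_width z m)"
proof -
  have "continuous_on S (\<lambda>lam. ell2 m * (1 + z * lam / sqrt (ell2 m)) powr (1 / lam)
      - ell2 m * (1 - z * lam / sqrt (ell2 m)) powr (1 / lam))"
    using assms by (intro continuous_intros) (use assms in \<open>force simp: ci_defined_def\<close>)+
  then show ?thesis
    by (rule continuous_on_eq) (use assms in \<open>auto simp: ci_width_def ci_upper_def ci_lower_def\<close>)
qed

theorem theorem6:
  fixes \<alpha> z :: real
  assumes "0 < \<alpha>" and "\<alpha> < 1"
    and "0 < z" and "cdf std_normal_distribution z = 1 - \<alpha> / 2"
  shows "asymptotically_minimized_at (ci_width z) (ci_defined z) at_top (3 / 4)"
  unfolding asymptotically_minimized_at_def
proof (intro conjI allI impI)
  fix x :: real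
  assume "x \<noteq> 3 / 4"
  then have "\<forall>\<^sub>F m in at_top. \<forall>lam. ci_defined z m lam \<longrightarrow> \<bar>x - 3 / 4\<bar> \<le> \<bar>lam - 3 / 4\<bar> \<longrightarrow>
      ci_width z m (3 / 4) < ci_width z m lam"
    using assms(3) by (intro ci_width_gt_away) auto
  moreover have "\<forall>\<^sub>F m in at_top. \<forall>lam. \<bar>lam\<bar> \<le> \<bar>x\<bar> + 1 \<longrightarrow> ci_defined z m lam"
    using assms(3) by (intro eventually_ci_defined_bounded) auto
  ultimately show "\<forall>\<^sub>F m in at_top. ci_defined z m (3 / 4) \<and> ci_defined z m x \<and>
      ci_width z m (3 / 4) < ci_width z m x"
    by eventually_elim auto
next
  fix \<epsilon> :: real
  assume "0 < \<epsilon>"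
  \<comment> \<open>Staying below \<open>1/4\<close> keeps the compact interval away from \<open>lam = 0\<close>, where the formula for the
    width changes.\<close>
  define \<delta> where "\<delta> = min \<epsilon> (1 / 4)"
  have \<delta>: "0 < \<delta>" "\<delta> \<le> \<epsilon>" "\<delta> \<le> 1 / 4" using \<open>0 < \<epsilon>\<close> by (auto simp: \<delta>_def)
  have "\<forall>\<^sub>F m in at_top. \<forall>lam. \<bar>lam\<bar> \<le> 1 \<longrightarrow> ci_defined z m lam"
    using assms(3) by (intro eventually_ci_defined_bounded) auto
  with ci_width_gt_away[OF assms(3) \<delta>(1)]
  show "\<forall>\<^sub>F m in at_top. (\<exists>x. is_arg_min (ci_width z m) (ci_defined z m) x) \<and>
      (\<forall>x. is_arg_min (ci_width z m) (ci_defined z m) x \<longrightarrow> \<bar>x - 3 / 4\<bar> < \<epsilon>)"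
  proof eventually_elim
    case (elim m)
    let ?I = "{3 / 4 - \<delta> .. 3 / 4 + \<delta>}"
    have dom: "lam \<noteq> 0 \<and> ci_defined z m lam" if "lam \<in> ?I" for lam
      using that \<delta> elim(2) by auto
    have c: "3 / 4 \<in> ?I" using \<delta> by simp
    obtain x where x: "x \<in> ?I" and min: "\<And>y. y \<in> ?I \<Longrightarrow> ci_width z m x \<le> ci_width z m y"
      using continuous_attains_inf[OF compact_Icc _ continuous_on_ci_width[of ?I z m, OF dom]] c
      by blast
    \<comment> \<open>The minimum over the compact interval is global: outside, the width exceeds
      its value at 3/4, a point of the interval.\<close>
    have "ci_width z m x \<le> ci_width z m y" if y: "ci_defined z m y" for y
    proof (cases "y \<in> ?I")
      case False
      then have "\<delta> \<le> \<bar>y - 3 / 4\<bar>" by auto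
      then have "ci_width z m (3 / 4) < ci_width z m y" using elim(1) y by blast
      with min[OF c] show ?thesis by simp
    qed (rule min)
    then have "is_arg_min (ci_width z m) (ci_defined z m) x"
      using dom[OF x] by (auto simp: is_arg_min_def not_less)
    moreover have "\<bar>y - 3 / 4\<bar> < \<epsilon>" if y: "is_arg_min (ci_width z m) (ci_defined z m) y" for y
    proof (rule ccontr)
      assume "\<not> \<bar>y - 3 / 4\<bar> < \<epsilon>"
      then have "\<delta> \<le> \<bar>y - 3 / 4\<bar>" using \<delta> by simp
      then have "ci_width z m (3 / 4) < ci_width z m y"
        using elim(1) y by (simp add: is_arg_min_def)
      with y dom[OF c] show False by (auto simp: is_arg_min_def)
    qed
    ultimately show ?case by blast
  qed
qed

end
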